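(* Let $K \subsetneq L$ be a field extension with at least one proper nontrivial finite-dimensional intermediate field (i.e. a field $F$ with $K\subsetneq F\subsetneq L$ and $[F:K]<\infty$). Let $\ell$ and $n$ be integers such that $\ell\geq 0$ and $n_0(K,L) \leq n < [L:K]$. Then there exist $n$-dimensional $K$-subspaces $A,B \subseteq L$ with $1 \notin B$ and $\delta(A,B)>\ell$ if and only if there exists an intermediate field $K \subsetneq F \subsetneq L$ with $[F:K] \leq n$ and $[F:K] \nmid (n+j)$ for all $j\in [\ell+1]$.
   Context: Fields are commutative. All dimensions are over $K$. $[k]=\{1,\dots,k\}$ for a positive integer $k$, and $\langle X\rangle$ denotes the $K$-span of a set $X$. The degree $[L:K]$ may be infinite, in which case $n<[L:K]$ holds for every integer $n$. Definition ($n_0$). $n_0(K,L)=\min_F [F:K]$, where the minimum is over all intermediate fields $K\subsetneq F\subseteq L$ with $[F:K]<\infty$. Definition (partial matching of bases). Let $A,B$ be $n$-dimensional $K$-subspaces of $L$, $n\ge 1$, and $0\le d\le n$ an integer. An ordered basis $\mathcal{A}=\{a_1,\dots,a_n\}$ of $A$ is partially matched to an ordered basis $\mathcal{B}=\{b_1,\dots,b_n\}$ of $B$ with defect $d$ if there exists $P\subseteq[n]$ with $|P|=n-d$ such that $$a_i^{-1}A\cap B\subseteq \langle b_1,\dots,b_{i-1},b_{i+1},\dots,b_n\rangle\quad\text{for each } i\in P.$$ Definition (partial matching of subspaces). $A$ is partially matched to $B$ with defect $d$ if for every ordered basis $\mathcal{A}$ of $A$ there exists an ordered basis $\mathcal{B}$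 of $B$ such that $\mathcal{A}$ is partially matched to $\mathcal{B}$ with defect $d$. Definition (deficiency). For $n$-dimensional $A,B$ with $0<n<\infty$ and $1\notin B$, $\delta(A,B)$ is the least nonnegative integer $d$ for which $A$ is partially matched to $B$ with defect $d$. *)

theory Defs
  imports "HOL-Algebra.Embedded_Algebras"
begin

text \<open>
  Throughout, the ambient ring \<open>R\<close> plays the role of the big field and \<open>K\<close> is a subfield
  of it. A set \<open>A\<close> with \<open>dimension n K A\<close> is built up by adjoining lines to the zero space,
  so it is in particular a \<open>K\<close>-subspace of the carrier.
\<close>

definition (in ring) intermediate_field :: "'a set \<Rightarrow> 'a set \<Rightarrow> bool"
  where "intermediate_field K F \<longleftrightarrow> subfield F R \<and> K \<subseteq> F"

text \<open>
  The infimum is taken in \<^typ>\<open>nat\<close>: it is the minimum as soon as some finite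
  intermediate field other than \<open>K\<close> exists, and the junk value 0 otherwise.
\<close>

definition (in ring) n0 :: "'a set \<Rightarrow> nat"
  where "n0 K = Inf {(dim over K) F | F. intermediate_field K F \<and> F \<noteq> K \<and> finite_dimension K F}"

definition (in ring) ordered_basis :: "'a set \<Rightarrow> 'a list \<Rightarrow> 'a set \<Rightarrow> bool"
  where "ordered_basis K Us V \<longleftrightarrow> independent K Us \<and> Span K Us = V"

text \<open>
  Positions in a basis are numbered from 0, so the index set is \<open>{..<n}\<close>. The list
  \<open>take i bs @ drop (Suc i) bs\<close> is \<open>bs\<close> with its entry at position \<open>i\<close> left out.
\<close>

definition (in ring) partially_matched_bases ::
    "'a set \<Rightarrow> 'a set \<Rightarrow> 'a set \<Rightarrow> 'a list \<Rightarrow> 'a list \<Rightarrow> nat \<Rightarrow> bool"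
  where "partially_matched_bases K A B as bs d \<longleftrightarrow>
    d \<le> length as \<and>
    (\<exists>P \<subseteq> {..<length as}. card P = length as - d \<and>
      (\<forall>i\<in>P. (inv (as ! i) <# A) \<inter> B \<subseteq> Span K (take i bs @ drop (Suc i) bs)))"

definition (in ring) partially_matched :: "'a set \<Rightarrow> 'a set \<Rightarrow> 'a set \<Rightarrow> nat \<Rightarrow> bool"
  where "partially_matched K A B d \<longleftrightarrow>
    (\<forall>as. ordered_basis K as A \<longrightarrow>
      (\<exists>bs. ordered_basis K bs B \<and> partially_matched_bases K A B as bs d))"

text \<open>
  For \<open>A\<close> and \<open>B\<close> of the same finite dimension \<open>n\<close>, the value \<open>d = n\<close> always qualifies
  (take the empty index set), so the least such \<open>d\<close> exists.
\<close>

definition (in ring) deficiency :: "'a set \<Rightarrow> 'a set \<Rightarrow> 'a set \<Rightarrow> nat"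
  where "deficiency K A B = (LEAST d. partially_matched K A B d)"

end

theory Submission
  imports Defs
begin

text \<open>
  An ordered basis \<open>a\<close> of \<open>A\<close> is matched with defect \<open>d\<close> iff hyperplanes \<open>V\<^sub>i \<supseteq> a\<^sub>i\<^sup>-\<^sup>1 A \<inter> B\<close> of
  \<open>B\<close> can be chosen for \<open>n - d\<close> of the indices in such a way that they are independent as linear
  forms. By the defect version of Rado's theorem, this fails for some basis \<open>a\<close> iff there is a
  set \<open>J\<close> of indices such that \<open>T = {x \<in> B. a\<^sub>i x \<in> A for i \<in> J}\<close> satisfies \<open>dim T + |J| > n + d\<close>.

  Given such an obstruction with \<open>d = l\<close>, put \<open>X = \<langle>a\<^sub>i. i \<in> J\<rangle>\<close> and \<open>Y = K \<oplus> T\<close>. Then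
  \<open>X Y \<subseteq> A\<close> and \<open>dim X + dim Y \<ge> n + l + 2\<close>. Dyson transforms lead to an intermediate field \<open>H\<close> and a
  multiple \<open>m \<le> n\<close> of \<open>h = [H:K]\<close> such that \<open>m + h \<ge> dim X + dim Y\<close>, so that
  \<open>n + 1, \<dots>, n + l + 1\<close> lie strictly between the multiples \<open>m\<close> and \<open>m + h\<close> of \<open>h\<close>.
  Unlike in Kneser's theorem for field extensions, the product space \<open>X Y\<close> itself need not be stable
  under \<open>H\<close>: it suffices that it contains an \<open>H\<close>-stable subspace of dimension \<open>m\<close>.

  Conversely, if \<open>n = h q + r\<close> with \<open>r + l + 1 < h = [F:K]\<close>, let \<open>A\<close> contain a \<open>q\<close>-dimensional
  \<open>F\<close>-space \<open>M\<close> and let \<open>B\<close> contain a complement \<open>T\<close> of \<open>K\<close> in \<open>F\<close>. Since \<open>M T \<subseteq> M\<close> and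
  \<open>dim M + dim T = h q + h - 1 > n + l\<close>, any basis of \<open>A\<close> that extends one of \<open>M\<close> is an obstruction.
\<close>

section \<open>Finite-dimensional subspaces\<close>

locale extension = field R for R (structure) +
  fixes K :: "'a set"
  assumes K: "subfield K R"
begin

abbreviation subspace :: "'a set \<Rightarrow> bool" where "subspace V \<equiv> subalgebra K V R"
abbreviation fin_dim :: "'a set \<Rightarrow> bool" where "fin_dim V \<equiv> finite_dimension K V"
abbreviation dm :: "'a set \<Rightarrow> nat" where "dm V \<equiv> (dim over K) V"

lemma scalar_in_carrier: "k \<in> K \<Longrightarrow> k \<in> carrier R"
  using K by (meson subfieldE(3) subsetD)

lemma subspaceD:
  assumes "subspace V"
  shows "V \<subseteq> carrier R" "\<And>x. x \<in> V \<Longrightarrow> x \<in> carrier R" "\<zero> \<in> V"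
    "\<And>x y. \<lbrakk> x \<in> V; y \<in> V \<rbrakk> \<Longrightarrow> x \<oplus> y \<in> V" "\<And>x. x \<in> V \<Longrightarrow> \<ominus> x \<in> V"
    "\<And>k x. \<lbrakk> k \<in> K; x \<in> V \<rbrakk> \<Longrightarrow> k \<otimes> x \<in> V"
    "\<And>x y. \<lbrakk> x \<in> V; y \<in> V \<rbrakk> \<Longrightarrow> x \<ominus> y \<in> V"
proof -
  interpret V: subgroup V "add_monoid R" using assms by (simp add: subalgebra_def)
  show c: "V \<subseteq> carrier R" "\<And>x. x \<in> V \<Longrightarrow> x \<in> carrier R" and "\<zero> \<in> V"
    using V.subset V.one_closed by auto
  show a: "\<And>x y. \<lbrakk> x \<in> V; y \<in> V \<rbrakk> \<Longrightarrow> x \<oplus> y \<in> V" using V.m_closed by simp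
  show m: "\<And>x. x \<in> V \<Longrightarrow> \<ominus> x \<in> V" using V.m_inv_closed by (simp add: a_inv_def)
  show "\<And>k x. \<lbrakk> k \<in> K; x \<in> V \<rbrakk> \<Longrightarrow> k \<otimes> x \<in> V"
    using assms subalgebra.smult_closed by fastforce
  show "\<And>x y. \<lbrakk> x \<in> V; y \<in> V \<rbrakk> \<Longrightarrow> x \<ominus> y \<in> V" using a m by (simp add: a_minus_def)
qed

lemma subspaceI:
  assumes "V \<subseteq> carrier R" "\<zero> \<in> V" "\<And>x y. \<lbrakk> x \<in> V; y \<in> V \<rbrakk> \<Longrightarrow> x \<oplus> y \<in> V"
    "\<And>k x. \<lbrakk> k \<in> K; x \<in> V \<rbrakk> \<Longrightarrow> k \<otimes> x \<in> V"
  shows "subspace V"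
proof -
  have "\<ominus> x \<in> V" if x: "x \<in> V" for x
  proof -
    have "\<ominus> \<one> \<in> K" using K by (simp add: subfieldE(1) subringE(3,5))
    hence "\<ominus> \<one> \<otimes> x \<in> V" using x assms(4) by blast
    thus ?thesis using x assms(1) by (metis l_minus l_one one_closed subsetD)
  qed
  thus ?thesis
    using assms unfolding subalgebra_def subalgebra_axioms_def
    by (auto intro!: group.subgroupI[OF a_group] simp flip: a_inv_def)
qed

lemma dimension_iff: "dimension n K V \<longleftrightarrow> fin_dim V \<and> dm V = n"
  using K dimI finite_dimensionE finite_dimensionI by metis

lemma fin_dim_subspace: "fin_dim V \<Longrightarrow> subspace V"
  using K finite_dimension_imp_subalgebra by blast

lemma fin_dim_subset: "\<lbrakk> fin_dim E; subspace V; V \<subseteq> E \<rbrakk> \<Longrightarrow> fin_dim V"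
  using K subalbegra_incl_imp_finite_dimension by blast

lemma ex_basis:
  assumes "fin_dim E"
  obtains Us where "independent K Us" "length Us = dm E" "Span K Us = E" "set Us \<subseteq> E"
proof -
  have "dimension (dm E) K E" using assms by (simp add: dimension_iff)
  from exists_base[OF K this] that show ?thesis using K Span_base_incl by metis
qed

lemma dm_mono:
  assumes "fin_dim E" "subspace V" "V \<subseteq> E"
  shows "dm V \<le> dm E" and "dm V = dm E \<Longrightarrow> V = E"
proof -
  have "fin_dim V" using assms fin_dim_subset by blast
  then obtain Us where U: "independent K Us" "length Us = dm V" "Span K Us = V" "set Us \<subseteq> V"
    using ex_basis by blast
  have E: "dimension (dm E) K E" using assms by (simp add: dimension_iff)
  show "dm V \<le> dm E"
    using independent_length_le_dimension[OF K E U(1)] U assms by auto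
  show "dm V = dm E \<Longrightarrow> V = E"
    using independent_length_eq_dimension[OF K E U(1)] U assms by auto
qed

lemma subspace_Int: "\<lbrakk> subspace V; subspace W \<rbrakk> \<Longrightarrow> subspace (V \<inter> W)"
  by (rule subalgebra_inter)

lemma subspace_INT:
  assumes "subspace B" "\<And>i. i \<in> J \<Longrightarrow> subspace (U i)"
  shows "subspace (B \<inter> (\<Inter>i\<in>J. U i))"
  by (rule subspaceI) (use subspaceD[OF assms(1)] subspaceD[OF assms(2)] in auto)

section \<open>Adjoining one vector to a subspace\<close>

lemma subspace_line_extension:
  assumes "subspace V" "v \<in> carrier R"
  shows "subspace (line_extension K v V)"
  unfolding subalgebra_def subalgebra_axioms_def
  using line_extension_is_subgroup[OF K _ assms(2)]
    line_extension_smult_closed[OF K _ _ assms(2)] assms(1) subspaceD[OF assms(1)]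
  by (simp add: subalgebra_def)

lemma line_extension_incl:
  assumes "subspace V" "v \<in> carrier R"
  shows "V \<subseteq> line_extension K v V" "v \<in> line_extension K v V"
proof -
  have 0: "\<zero> \<in> K" "\<one> \<in> K" using K by (simp_all add: subfieldE(1) subringE(2,3))
  show "V \<subseteq> line_extension K v V"
  proof
    fix x assume x: "x \<in> V"
    hence "x = \<zero> \<otimes> v \<oplus> x" using assms(2) subspaceD(2)[OF assms(1)] by simp
    thus "x \<in> line_extension K v V" unfolding line_extension_mem_iff using 0 x by blast
  qed
  show "v \<in> line_extension K v V"
  proof -
    have "v = \<one> \<otimes> v \<oplus> \<zero>" using assms(2) by simp
    thus ?thesis unfolding line_extension_mem_iff using 0 subspaceD(3)[OF assms(1)] by blast
  qed
qed

lemma line_extension_subset: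
  assumes "subspace E" "V \<subseteq> E" "v \<in> E"
  shows "line_extension K v V \<subseteq> E"
  proof
  fix x assume "x \<in> line_extension K v V"
  then obtain k w where "k \<in> K" "w \<in> V" "x = k \<otimes> v \<oplus> w" by (auto simp: line_extension_mem_iff)
  thus "x \<in> E" using subspaceD(4,6)[OF assms(1)] assms(2,3) by blast
qed

lemma dm_line_extension:
  assumes "fin_dim V" "v \<in> carrier R" "v \<notin> V"
  shows "fin_dim (line_extension K v V)" "dm (line_extension K v V) = Suc (dm V)"
  using Suc_dim[OF assms(2,3)] assms(1) dimension_iff by auto

section \<open>Dimensions of sums and intersections\<close>

lemma dm_sum:
  assumes "fin_dim V" "fin_dim W"
  shows "fin_dim (V <+>\<^bsub>R\<^esub> W)" "dm (V <+>\<^bsub>R\<^esub> W) + dm (V \<inter> W) = dm V + dm W"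
proof -
  show "fin_dim (V <+>\<^bsub>R\<^esub> W)" using sum_space_dim(1)[OF K assms] .
  have "dm (V \<inter> W) \<le> dm V"
    using assms by (intro dm_mono subspace_Int fin_dim_subspace) auto
  thus "dm (V <+>\<^bsub>R\<^esub> W) + dm (V \<inter> W) = dm V + dm W"
    using sum_space_dim(2)[OF K assms] by simp
qed

lemma sum_mem_iff: "x \<in> V <+>\<^bsub>R\<^esub> W \<longleftrightarrow> (\<exists>v\<in>V. \<exists>w\<in>W. x = v \<oplus> w)"
  by (auto simp: set_add_def')

lemma sum_subset: "\<lbrakk> subspace E; V \<subseteq> E; W \<subseteq> E \<rbrakk> \<Longrightarrow> V <+>\<^bsub>R\<^esub> W \<subseteq> E"
  unfolding subset_iff sum_mem_iff using subspaceD(4) by blast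

lemma sum_incl:
  assumes "subspace V" "subspace W"
  shows "V \<subseteq> V <+>\<^bsub>R\<^esub> W" "W \<subseteq> V <+>\<^bsub>R\<^esub> W"
  unfolding subset_iff sum_mem_iff
  using subspaceD(2,3)[OF assms(1)] subspaceD(2,3)[OF assms(2)] l_zero r_zero by metis+

text \<open>The sum of \<open>V\<close> and \<open>W\<close> still lies in \<open>E\<close>, so the
  dimension formula yields the bound. It supplies the submodularity for Rado's argument.\<close>

lemma dm_Int_ge:
  assumes "fin_dim E" "subspace V" "subspace W" "V \<subseteq> E" "W \<subseteq> E"
  shows "dm V + dm W \<le> dm E + dm (V \<inter> W)"
proof -
  have f: "fin_dim V" "fin_dim W" using assms fin_dim_subset by auto
  have "V <+>\<^bsub>R\<^esub> W \<subseteq> E" using assms fin_dim_subspace sum_subset by simp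
  thus ?thesis using dm_sum[OF f] dm_mono(1)[OF assms(1) fin_dim_subspace] by fastforce
qed

lemma dm_gt_0: "\<lbrakk> fin_dim V; v \<in> V; v \<noteq> \<zero> \<rbrakk> \<Longrightarrow> 0 < dm V"
  using dimension_zero[OF K] dimension_iff by (metis gr0I singletonD)

section \<open>Multiplication by a nonzero element\<close>

lemma dimension_scale:
  assumes "dimension n K E" "z \<in> carrier R" "z \<noteq> \<zero>"
  shows "dimension n K (z <# E)"
  using assms(1)
proof (induction n arbitrary: E)
  case 0
  have "z <# {\<zero>} = {\<zero>}" using assms by (auto simp: l_coset_def)
  then show ?case using dimension_zero[OF K 0] by simp
next
  case (Suc n E')
  then obtain v E where Suc_dim: "v \<in> carrier R" "dimension n K E" "v \<notin> E"
    and E': "E' = line_extension K v E"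
    using dimension_backwards[OF K] by blast
  have E: "subspace E" using Suc_dim fin_dim_subspace dimension_iff by blast
  note sD = subspaceD[OF E]
  have "z <# line_extension K v E = line_extension K (z \<otimes> v) (z <# E)"
  proof (intro equalityI subsetI)
    fix x assume "x \<in> z <# line_extension K v E"
    then obtain k e where ke: "k \<in> K" "e \<in> E" "x = z \<otimes> (k \<otimes> v \<oplus> e)"
      by (auto simp: l_coset_def line_extension_mem_iff)
    have "x = k \<otimes> (z \<otimes> v) \<oplus> z \<otimes> e"
      using ke sD Suc_dim assms scalar_in_carrier by (simp add: r_distr m_lcomm)
    thus "x \<in> line_extension K (z \<otimes> v) (z <# E)"
      using ke by (auto simp: l_coset_def line_extension_mem_iff)
  next
    fix x assume "x \<in> line_extension K (z \<otimes> v) (z <# E)"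
    then obtain k e where ke: "k \<in> K" "e \<in> E" "x = k \<otimes> (z \<otimes> v) \<oplus> z \<otimes> e"
      by (auto simp: l_coset_def line_extension_mem_iff)
    have "x = z \<otimes> (k \<otimes> v \<oplus> e)"
      using ke sD Suc_dim assms scalar_in_carrier by (simp add: r_distr m_lcomm)
    moreover have "k \<otimes> v \<oplus> e \<in> line_extension K v E"
      using ke line_extension_mem_iff by blast
    ultimately show "x \<in> z <# line_extension K v E" by (auto simp: l_coset_def)
  qed
  moreover have "z \<otimes> v \<notin> z <# E"
    using sD Suc_dim assms m_lcancel by (auto simp: l_coset_def)
  ultimately show ?case using Suc_dim Suc.IH E' assms by (auto intro: dimension.Suc_dim)
qed

lemma scale_props:
  assumes "fin_dim E" "z \<in> carrier R" "z \<noteq> \<zero>"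
  shows "fin_dim (z <# E)" "dm (z <# E) = dm E"
  using dimension_scale[OF _ assms(2,3)] assms(1) dimension_iff by auto

lemma scale_mem_iff:
  assumes "E \<subseteq> carrier R" "z \<in> carrier R" "z \<noteq> \<zero>"
  shows "x \<in> inv z <# E \<longleftrightarrow> x \<in> carrier R \<and> z \<otimes> x \<in> E"
proof -
  have z: "inv z \<in> carrier R" "inv z \<otimes> z = \<one>" "z \<otimes> inv z = \<one>" using assms field_Units by auto
  show ?thesis
  proof
    assume "x \<in> inv z <# E"
    then obtain e where "e \<in> E" "x = inv z \<otimes> e" by (auto simp: l_coset_def)
    thus "x \<in> carrier R \<and> z \<otimes> x \<in> E" using z assms
      by (metis l_one m_assoc m_closed subsetD)
  next
    assume x: "x \<in> carrier R \<and> z \<otimes> x \<in> E"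
    have "x = inv z \<otimes> (z \<otimes> x)" using x z assms by (metis l_one m_assoc)
    thus "x \<in> inv z <# E" using x by (auto simp: l_coset_def)
  qed
qed

text \<open>Each entry raises the dimension of the span by at most one, so the maximal value forces
  every entry to lie outside the span of those after it.\<close>

lemma independent_of_dm_Span:
  assumes "set Us \<subseteq> carrier R"
  shows "dm (Span K Us) \<le> length Us \<and> (dm (Span K Us) = length Us \<longrightarrow> independent K Us)"
  using assms
proof (induction Us)
  case Nil
  have "dm {\<zero>} = 0" using dimI[OF K zero_dim] .
  then show ?case by simp
next
  case (Cons u Us)
  have fs: "fin_dim (Span K Us)" using Cons K Span_finite_dimension by simp
  show ?case
  proof (cases "u \<in> Span K Us")
    case True
    have "Span K (u # Us) \<subseteq> Span K Us"
      using Cons True K Span_base_incl[OF K] by (intro mono_Span_subset) auto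
    hence "Span K (u # Us) = Span K Us" using mono_Span[OF K] Cons by auto
    thus ?thesis using Cons by simp
  next
    case False
    have "dm (Span K (u # Us)) = Suc (dm (Span K Us))"
      using dm_line_extension(2)[OF fs _ False] Cons by simp
    thus ?thesis using Cons False li_Cons by auto
  qed
qed

section \<open>The defect version of Rado's theorem\<close>

text \<open>
  Rado's argument: a subspace of codimension at least 2 is the intersection of two subspaces that
  are larger by one dimension, and by submodularity it can be replaced by one of them.
\<close>

lemma rado_enlarge:
  fixes U :: "nat \<Rightarrow> 'a set"
  assumes B: "fin_dim B" and I: "finite I"
    and U: "\<And>i. i \<in> I \<Longrightarrow> subspace (U i) \<and> U i \<subseteq> B"
    and hall: "\<And>J. J \<subseteq> I \<Longrightarrow> dm (B \<inter> (\<Inter>i\<in>J. U i)) + card J \<le> dm B + l"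
  shows "\<exists>U'. (\<forall>i\<in>I. subspace (U' i) \<and> U i \<subseteq> U' i \<and> U' i \<subseteq> B \<and> dm B \<le> Suc (dm (U' i))) \<and>
           dm (B \<inter> (\<Inter>i\<in>I. U' i)) + card I \<le> dm B + l"
  using U hall
proof (induction "\<Sum>i\<in>I. dm B - dm (U i)" arbitrary: U rule: less_induct)
  case less
  \<comment> \<open>The induction runs on the total codimension of the \<open>U i\<close> in
    \<open>B\<close>; enlarging a single \<open>U i\<close> by one dimension lowers it.\<close>
  note U = less.prems(1) and hall = less.prems(2)
  note sB = fin_dim_subspace[OF B]
  have fU: "fin_dim (U i)" if "i \<in> I" for i using that U fin_dim_subset[OF B] by blast
  define D where "D V J = B \<inter> (\<Inter>i\<in>J. V i)" for V :: "nat \<Rightarrow> 'a set" and J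
  show ?case
  proof (cases "\<exists>i\<in>I. Suc (dm (U i)) < dm B")
    case False
    then show ?thesis using U hall[of I] by (intro exI[of _ U]) auto
  next
    case True
    then obtain i where i: "i \<in> I" "Suc (dm (U i)) < dm B" by blast
    define V where "V = U i"
    have V: "subspace V" "V \<subseteq> B" "fin_dim V" using U fU i V_def by auto
    have "V \<noteq> B" using i V_def by auto
    then obtain u where u: "u \<in> B" "u \<notin> V" using V by auto
    define V1 where "V1 = line_extension K u V"
    have uc: "u \<in> carrier R" using u sB subspaceD by blast
    have V1: "subspace V1" "V \<subseteq> V1" "V1 \<subseteq> B" "fin_dim V1" "dm V1 = Suc (dm V)" "u \<in> V1"
      unfolding V1_def
      using subspace_line_extension[OF V(1) uc] line_extension_incl[OF V(1) uc]
        line_extension_subset[OF sB V(2) u(1)] dm_line_extension[OF V(3) uc u(2)] by auto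
    have "V1 \<noteq> B" using i V_def V1 by auto
    then obtain w where w: "w \<in> B" "w \<notin> V1" using V1 by auto
    define V2 where "V2 = line_extension K w V"
    have wc: "w \<in> carrier R" using w sB subspaceD by blast
    have wV: "w \<notin> V" using w V1 by auto
    have V2: "subspace V2" "V \<subseteq> V2" "V2 \<subseteq> B" "fin_dim V2" "dm V2 = Suc (dm V)" "w \<in> V2"
      unfolding V2_def
      using subspace_line_extension[OF V(1) wc] line_extension_incl[OF V(1) wc]
        line_extension_subset[OF sB V(2) w(1)] dm_line_extension[OF V(3) wc wV] by auto
    \<comment> \<open>\<open>V1\<close> and \<open>V2\<close> both exceed \<open>V\<close> by one
      dimension, and \<open>w\<close> lies in \<open>V2\<close> but not in \<open>V1\<close>, so
      nothing beyond \<open>V\<close> is common to them.\<close>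
    have V12: "V1 \<inter> V2 = V"
    proof (rule sym, rule dm_mono(2))
      show f: "fin_dim (V1 \<inter> V2)"
        using V1 V2 fin_dim_subset[OF V1(4)] subspace_Int by blast
      show "subspace V" "V \<subseteq> V1 \<inter> V2" using V V1 V2 by auto
      have "V1 \<inter> V2 \<noteq> V2" using V2 w by auto
      moreover have "subspace (V1 \<inter> V2)" using V1 V2 subspace_Int by blast
      ultimately have "dm (V1 \<inter> V2) < dm V2" using dm_mono[OF V2(4), of "V1 \<inter> V2"]
        unfolding order_less_le by blast
      thus "dm V = dm (V1 \<inter> V2)"
        using V2(5) dm_mono(1)[OF f V(1)] V1(2) V2(2) by auto
    qed
    have step: ?thesis if X: "subspace X" "V \<subseteq> X" "X \<subseteq> B" "dm X = Suc (dm V)"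
      and h: "\<And>J. J \<subseteq> I \<Longrightarrow> dm (D (U(i := X)) J) + card J \<le> dm B + l" for X
    proof -
      let ?U = "U(i := X)"
      have "(\<Sum>j\<in>I. dm B - dm (?U j)) < (\<Sum>j\<in>I. dm B - dm (U j))"
        using I i X V_def by (intro sum_strict_mono_ex1) auto
      from less.hyps[OF this] U X h obtain U' where
        "\<forall>j\<in>I. subspace (U' j) \<and> ?U j \<subseteq> U' j \<and> U' j \<subseteq> B \<and> dm B \<le> Suc (dm (U' j))"
        "dm (B \<inter> (\<Inter>i\<in>I. U' i)) + card I \<le> dm B + l"
        unfolding D_def by (smt (verit, best) fun_upd_apply)
      thus ?thesis using X(2) V_def by (intro exI[of _ U']) (auto split: if_splits)
    qed
    \<comment> \<open>Replacing \<open>U i\<close> by \<open>X\<close> can only break the condition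
      for index sets containing \<open>i\<close>. Such a set is recorded with \<open>i\<close>
      removed, whence the \<open>Suc\<close>.\<close>
    have bad: "\<exists>J. J \<subseteq> I \<and> i \<notin> J \<and> dm B + l < dm (X \<inter> D U J) + Suc (card J)"
      if X: "subspace X" "X \<subseteq> B"
      and J: "J \<subseteq> I" "\<not> dm (D (U(i := X)) J) + card J \<le> dm B + l" for X J
    proof -
      have iJ: "i \<in> J"
      proof (rule ccontr)
        assume "i \<notin> J"
        hence "D (U(i := X)) J = B \<inter> (\<Inter>j\<in>J. U j)" unfolding D_def by auto
        thus False using J hall by auto
      qed
      have "D (U(i := X)) J = X \<inter> D U (J - {i})" unfolding D_def using X iJ by auto
      moreover have "card J = Suc (card (J - {i}))"
        using iJ J I by (metis card.remove finite_subset)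
      ultimately show ?thesis using J by (intro exI[of _ "J - {i}"]) auto
    qed
    have sD: "subspace (D U J)" if "J \<subseteq> I" for J
      unfolding D_def using that U by (intro subspace_INT sB) auto
    show ?thesis
    proof (rule ccontr)
      assume n: "\<not> ?thesis"
      obtain J1 where J1: "J1 \<subseteq> I" "i \<notin> J1" "dm B + l < dm (V1 \<inter> D U J1) + Suc (card J1)"
        using n step[OF V1(1-3,5)] bad[OF V1(1,3)] by blast
      obtain J2 where J2: "J2 \<subseteq> I" "i \<notin> J2" "dm B + l < dm (V2 \<inter> D U J2) + Suc (card J2)"
        using n step[OF V2(1-3,5)] bad[OF V2(1,3)] by blast
      \<comment> \<open>If both enlargements fail, the two violations add up. Submodularity compares
        the sum with the condition for \<open>J1 \<inter> J2\<close> and for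
        \<open>insert i (J1 \<union> J2)\<close>; the index \<open>i\<close> is counted twice in the
        violations but only once here, which gives the contradiction.\<close>
      let ?E = "D U (J1 \<inter> J2)" and ?V = "V1 \<inter> D U J1" and ?W = "V2 \<inter> D U J2"
      have fin: "finite J1" "finite J2" using J1 J2 I finite_subset by auto
      have "?E \<subseteq> B" "?V \<subseteq> ?E" "?W \<subseteq> ?E" unfolding D_def by auto
      moreover have "subspace ?E" using sD[of "J1 \<inter> J2"] J1 by auto
      moreover have "fin_dim ?E" using fin_dim_subset[OF B] calculation by blast
      ultimately have "dm ?V + dm ?W \<le> dm ?E + dm (?V \<inter> ?W)"
        using V1 V2 sD J1 J2 subspace_Int by (intro dm_Int_ge) auto
      moreover have "dm (?V \<inter> ?W) = dm (D U (insert i (J1 \<union> J2)))"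
        using V12 unfolding D_def V_def by (intro arg_cong[of _ _ dm]) auto
      moreover have "dm (D U (insert i (J1 \<union> J2))) + card (insert i (J1 \<union> J2)) \<le> dm B + l"
        using hall[of "insert i (J1 \<union> J2)"] J1 J2 i unfolding D_def by blast
      moreover have "card (insert i (J1 \<union> J2)) = Suc (card (J1 \<union> J2))" using J1 J2 fin by simp
      moreover have "dm ?E + card (J1 \<inter> J2) \<le> dm B + l"
        using hall[of "J1 \<inter> J2"] J1 unfolding D_def by blast
      moreover have "card (J1 \<union> J2) + card (J1 \<inter> J2) = card J1 + card J2"
        using card_Un_Int[OF fin] by simp
      ultimately show False using J1 J2 by linarith
    qed
  qed
qed

text \<open>Greedy elimination: an index is kept only if its subspace cuts down the intersection
  obtained so far. The kept subspaces are hyperplanes of \<open>B\<close>, independent as linear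
  forms, and the \<open>b i\<close> are dual to these forms up to nonzero scalars.\<close>

lemma dual_system:
  fixes U :: "nat \<Rightarrow> 'a set"
  assumes B: "fin_dim B" and "finite I"
    and "\<And>i. i \<in> I \<Longrightarrow> subspace (U i) \<and> U i \<subseteq> B \<and> dm B \<le> Suc (dm (U i))"
  shows "\<exists>P b. P \<subseteq> I \<and> (\<forall>i\<in>P. b i \<in> B - U i \<and> (\<forall>j\<in>P - {i}. b i \<in> U j)) \<and>
           B \<inter> (\<Inter>i\<in>P. U i) = B \<inter> (\<Inter>i\<in>I. U i) \<and> dm (B \<inter> (\<Inter>i\<in>P. U i)) + card P = dm B"
  using assms(2,3)
proof (induction I rule: finite_induct)
  case empty
  then show ?case by auto
next
  case (insert i I)
  note sB = fin_dim_subspace[OF B]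
  obtain P b where P: "P \<subseteq> I" "\<And>i. i \<in> P \<Longrightarrow> b i \<in> B - U i"
      "\<And>i j. i \<in> P \<Longrightarrow> j \<in> P - {i} \<Longrightarrow> b i \<in> U j"
      "B \<inter> (\<Inter>i\<in>P. U i) = B \<inter> (\<Inter>i\<in>I. U i)" "dm (B \<inter> (\<Inter>i\<in>P. U i)) + card P = dm B"
    using insert by (metis (no_types, lifting) insertCI)
  define W where "W = B \<inter> (\<Inter>i\<in>P. U i)"
  have Ui: "subspace (U i)" "U i \<subseteq> B" "dm B \<le> Suc (dm (U i))" using insert.prems by auto
  have UP: "subspace (U j)" if "j \<in> P" for j using insert.prems P(1) that by blast
  have sW: "subspace W" unfolding W_def using UP by (intro subspace_INT sB)
  show ?case
  proof (cases "W \<subseteq> U i")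
    case True
    hence "B \<inter> (\<Inter>i\<in>P. U i) = B \<inter> (\<Inter>i\<in>insert i I. U i)" using P(4) W_def by auto
    thus ?thesis using P by (intro exI[of _ P] exI[of _ b]) blast
  next
    case False
    then obtain w where w: "w \<in> W" "w \<notin> U i" by auto
    hence wB: "w \<in> B" "w \<in> carrier R" using W_def subspaceD[OF sB] by auto
    have iP: "i \<notin> P" using P(1) insert.hyps by blast
    have fP: "finite P" using P(1) insert.hyps finite_subset by blast
    have fUi: "fin_dim (U i)" using Ui fin_dim_subset[OF B] by blast
    \<comment> \<open>\<open>U i\<close> has codimension at most one and misses \<open>w\<close>, so
      every vector of \<open>B\<close> is a multiple of \<open>w\<close> modulo
      \<open>U i\<close>.\<close>
    have "line_extension K w (U i) = B"
      using dm_line_extension[OF fUi wB(2) w(2)] Ui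
        dm_mono(2)[OF B subspace_line_extension[OF Ui(1) wB(2)]]
        dm_mono(1)[OF B subspace_line_extension[OF Ui(1) wB(2)]]
        line_extension_subset[OF sB Ui(2) wB(1)] by simp
    hence dec: "\<exists>k\<in>K. v \<ominus> k \<otimes> w \<in> U i" if v: "v \<in> B" for v
    proof -
      from v \<open>line_extension K w (U i) = B\<close> obtain k u where
        ku: "k \<in> K" "u \<in> U i" "v = k \<otimes> w \<oplus> u" by (auto simp: line_extension_mem_iff)
      have "k \<otimes> w \<in> carrier R" "u \<in> carrier R"
        using ku scalar_in_carrier wB subspaceD(2)[OF Ui(1)] by auto
      hence "v \<ominus> k \<otimes> w = u" using ku by algebra
      thus ?thesis using ku(1,2) by metis
    qed
    define c where "c j = (SOME k. k \<in> K \<and> b j \<ominus> k \<otimes> w \<in> U i)" for j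
    have c: "c j \<in> K" "b j \<ominus> c j \<otimes> w \<in> U i" if "j \<in> P" for j
      using someI_ex[of "\<lambda>k. k \<in> K \<and> b j \<ominus> k \<otimes> w \<in> U i"] dec[of "b j"] P(2)[OF that]
      unfolding c_def by auto
    \<comment> \<open>Subtracting a multiple of \<open>w\<close> moves \<open>b j\<close> into
      \<open>U i\<close>. As \<open>w\<close> lies in every \<open>U m\<close> with \<open>m\<close>
      in \<open>P\<close>, the duality relations already established survive.\<close>
    define b' where "b' = (\<lambda>j. if j = i then w else b j \<ominus> c j \<otimes> w)"
    have wU: "c j \<otimes> w \<in> U m" "w \<in> U m" if "j \<in> P" "m \<in> P" for j m
      using that w c subspaceD(6)[OF UP] unfolding W_def by auto
    have b'B: "b' j \<in> B" if "j \<in> insert i P" for j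
      using that wB c P(2) subspaceD(6,7)[OF sB] unfolding b'_def by auto
    have b'n: "b' j \<notin> U j" if "j \<in> insert i P" for j
    proof (cases "j = i")
      case True
      thus ?thesis using w b'_def by auto
    next
      case False
      hence jP: "j \<in> P" using that by auto
      show ?thesis
      proof
        assume "b' j \<in> U j"
        hence "b j \<ominus> c j \<otimes> w \<oplus> c j \<otimes> w \<in> U j"
          using False b'_def wU[OF jP jP] subspaceD(4)[OF UP[OF jP]] by auto
        moreover have "b j \<in> carrier R" "c j \<otimes> w \<in> carrier R"
          using jP P(2) subspaceD(2)[OF sB] c wB scalar_in_carrier by auto
        hence "b j \<ominus> c j \<otimes> w \<oplus> c j \<otimes> w = b j" by algebra
        ultimately show False using P(2)[OF jP] by auto
      qed
    qed
    have b'm: "b' j \<in> U m" if "j \<in> insert i P" "m \<in> insert i P - {j}" for j m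
      using that iP c wU P(3) subspaceD(7)[OF UP] unfolding b'_def by auto
    have W': "B \<inter> (\<Inter>j\<in>insert i P. U j) = W \<inter> U i" unfolding W_def by auto
    have fW: "fin_dim W" using fin_dim_subset[OF B sW] W_def by auto
    have sW': "subspace (W \<inter> U i)" using subspace_Int sW Ui by blast
    \<comment> \<open>The vector \<open>w\<close> forces a drop in dimension, and a subspace of
      codimension at most one cannot cause a drop of more than one.\<close>
    have "dm (W \<inter> U i) < dm W"
      using dm_mono[OF fW sW'] w by (metis IntE Int_lower1 order_less_le)
    moreover have "dm W + dm (U i) \<le> dm B + dm (W \<inter> U i)"
      using W_def Ui sW by (intro dm_Int_ge B) auto
    ultimately have "dm W = Suc (dm (W \<inter> U i))" using Ui by linarith
    hence "dm (B \<inter> (\<Inter>j\<in>insert i P. U j)) + card (insert i P) = dm B"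
      unfolding W' using P(5) W_def iP fP by simp
    moreover have "B \<inter> (\<Inter>j\<in>insert i P. U j) = B \<inter> (\<Inter>j\<in>insert i I. U j)"
      unfolding W' W_def P(4) by auto
    moreover have "insert i P \<subseteq> insert i I" using P(1) by blast
    moreover have "\<forall>j\<in>insert i P. b' j \<in> B - U j \<and> (\<forall>m\<in>insert i P - {j}. b' j \<in> U m)"
      using b'B b'n b'm by blast
    ultimately show ?thesis by blast
  qed
qed

lemma set_take_drop_Suc:
  assumes "i < length xs"
  shows "set (take i xs @ drop (Suc i) xs) = (!) xs ` ({..<length xs} - {i})"
proof -
  have "take i xs @ drop (Suc i) xs = map ((!) xs) ([0..<i] @ [Suc i..<length xs])"
    using arg_cong[OF map_nth[of xs], of "take i"] arg_cong[OF map_nth[of xs], of "drop (Suc i)"]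
      assms by (simp add: take_map drop_map)
  moreover have "set ([0..<i] @ [Suc i..<length xs]) = {..<length xs} - {i}" using assms by auto
  ultimately show ?thesis by (simp only: set_map)
qed

lemma dual_system_dm_le:
  fixes V :: "nat \<Rightarrow> 'a set"
  assumes fS: "fin_dim S" and W: "subspace W" "W \<subseteq> S" and fP: "finite P"
    and V: "\<And>i. i \<in> P \<Longrightarrow> subspace (V i)" "\<And>i. i \<in> P \<Longrightarrow> W \<subseteq> V i"
    and f: "\<And>i. i \<in> P \<Longrightarrow> f i \<in> S" "\<And>i. i \<in> P \<Longrightarrow> f i \<notin> V i"
      "\<And>i j. i \<in> P \<Longrightarrow> j \<in> P - {i} \<Longrightarrow> f i \<in> V j"
  shows "dm W + card P \<le> dm S"
proof -
  note sS = fin_dim_subspace[OF fS]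
  have "\<exists>E. subspace E \<and> E \<subseteq> S \<and> dm E = dm W + card Q \<and> (\<forall>i\<in>P - Q. E \<subseteq> V i)"
    if "Q \<subseteq> P" for Q
    using finite_subset[OF that fP] that
  proof (induction Q rule: finite_induct)
    case empty
    show ?case using W V by (intro exI[of _ W]) auto
  next
    case (insert i Q)
    then obtain E where E: "subspace E" "E \<subseteq> S" "dm E = dm W + card Q"
      "\<And>j. j \<in> P - Q \<Longrightarrow> E \<subseteq> V j" by auto
    have i: "i \<in> P" "i \<notin> Q" using insert by auto
    have fi: "f i \<in> carrier R" using f(1)[OF i(1)] subspaceD[OF sS] by auto
    have nE: "f i \<notin> E" using E(4)[of i] i f(2) by auto
    have fE: "fin_dim E" using fin_dim_subset[OF fS] E by blast
    have "line_extension K (f i) E \<subseteq> V j" if "j \<in> P - insert i Q" for j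
      using that E(4) V f(3)[OF i(1)] by (intro line_extension_subset) auto
    moreover have "dm (line_extension K (f i) E) = dm W + card (insert i Q)"
      using dm_line_extension[OF fE fi nE] E(3) insert by simp
    ultimately show ?case
      using subspace_line_extension[OF E(1) fi] line_extension_subset[OF sS E(2) f(1)[OF i(1)]]
      by blast
  qed
  from this[OF subset_refl] obtain E where
    "subspace E" "E \<subseteq> S" "dm E = dm W + card P" by metis
  thus ?thesis using dm_mono(1)[OF fS, of E] by simp
qed

text \<open>Rado enlargement raises each \<open>U i\<close> to codimension at most one,
  \<open>dual_system\<close> selects independent hyperplanes with dual vectors, and a basis of their
  common intersection fills the remaining positions of \<open>bs\<close>.\<close>

lemma exists_matched_basis:
  fixes U :: "nat \<Rightarrow> 'a set"
  assumes B: "fin_dim B" "dm B = n"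
    and U: "\<And>i. i < n \<Longrightarrow> subspace (U i) \<and> U i \<subseteq> B"
    and hall: "\<And>J. J \<subseteq> {..<n} \<Longrightarrow> dm (B \<inter> (\<Inter>i\<in>J. U i)) + card J \<le> n + l"
  shows "\<exists>bs P. ordered_basis K bs B \<and> P \<subseteq> {..<n} \<and> card P = n - l \<and>
           (\<forall>i\<in>P. U i \<subseteq> Span K (take i bs @ drop (Suc i) bs))"
proof -
  note sB = fin_dim_subspace[OF B(1)]
  have "\<exists>V. (\<forall>i\<in>{..<n}. subspace (V i) \<and> U i \<subseteq> V i \<and> V i \<subseteq> B \<and> dm B \<le> Suc (dm (V i))) \<and>
           dm (B \<inter> (\<Inter>i\<in>{..<n}. V i)) + card {..<n} \<le> dm B + l"
    using U hall B by (intro rado_enlarge) auto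
  \<comment> \<open>Since there are \<open>n = dm B\<close> indices, the bound for the full index
    set says that the \<open>V i\<close> intersect in dimension at most \<open>l\<close>.\<close>
  then obtain V where
    V: "\<And>i. i < n \<Longrightarrow> subspace (V i) \<and> U i \<subseteq> V i \<and> V i \<subseteq> B \<and> dm B \<le> Suc (dm (V i))"
    and Vn: "dm (B \<inter> (\<Inter>i\<in>{..<n}. V i)) \<le> l"
    using B(2) by (metis (no_types, lifting) add.commute add_le_cancel_left card_lessThan lessThan_iff)
  obtain P b where P: "P \<subseteq> {..<n}" "\<And>i. i \<in> P \<Longrightarrow> b i \<in> B - V i"
      "\<And>i j. i \<in> P \<Longrightarrow> j \<in> P - {i} \<Longrightarrow> b i \<in> V j"
      "B \<inter> (\<Inter>i\<in>P. V i) = B \<inter> (\<Inter>i\<in>{..<n}. V i)" "dm (B \<inter> (\<Inter>i\<in>P. V i)) + card P = dm B"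
    using dual_system[OF B(1) finite_lessThan, of n V] V by (metis lessThan_iff)
  define W where "W = B \<inter> (\<Inter>i\<in>P. V i)"
  have fP: "finite P" using P(1) finite_subset by blast
  have VP: "subspace (V i)" "V i \<subseteq> B" "dm B \<le> Suc (dm (V i))" "U i \<subseteq> V i" if "i \<in> P" for i
    using that P(1) V by auto
  have sW: "subspace W" unfolding W_def using VP by (intro subspace_INT sB)
  have fW: "fin_dim W" using fin_dim_subset[OF B(1) sW] W_def by auto
  obtain ws where ws: "length ws = dm W" "Span K ws = W" "set ws \<subseteq> W"
    using ex_basis[OF fW] by metis
  \<comment> \<open>The free positions are exactly as many as the dimension of \<open>W\<close>, so
    \<open>g\<close> can distribute the basis \<open>ws\<close> over them.\<close>
  have "card ({..<n} - P) = length ws"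
    using P(1,5) W_def ws B fP by (simp add: card_Diff_subset)
  then obtain g where g: "bij_betw g ({..<n} - P) {..<length ws}"
    using finite_same_card_bij[of "{..<n} - P" "{..<length ws}"] by auto
  define f where "f i = (if i \<in> P then b i else ws ! g i)" for i
  define bs where "bs = map f [0..<n]"
  have fws: "f i \<in> W" if "i < n" "i \<notin> P" for i
    using that g ws(3) unfolding f_def bij_betw_def by (auto intro!: subsetD[OF ws(3)] nth_mem)
  have fB: "f i \<in> B" if "i < n" for i
    using that fws[OF that] P(2) unfolding f_def W_def by auto
  have fV: "f i \<in> V j" if "i < n" "j \<in> P" "i \<noteq> j" for i j
  proof (cases "i \<in> P")
    case True
    thus ?thesis using P(3)[OF True, of j] that f_def by auto
  next
    case False
    thus ?thesis using fws[OF that(1)] that W_def by auto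
  qed
  have sbs: "set bs = f ` {..<n}" unfolding bs_def by auto
  hence bsB: "set bs \<subseteq> B" using fB by auto
  hence bsc: "set bs \<subseteq> carrier R" using subspaceD(1)[OF sB] by auto
  have "set ws \<subseteq> f ` ({..<n} - P)"
  proof
    fix x assume "x \<in> set ws"
    then obtain m where m: "m < length ws" "x = ws ! m" by (auto simp: in_set_conv_nth)
    hence "m \<in> g ` ({..<n} - P)" using g unfolding bij_betw_def by auto
    thus "x \<in> f ` ({..<n} - P)" using m unfolding f_def by auto
  qed
  hence wsbs: "set ws \<subseteq> set bs" using sbs by auto
  hence WS: "W \<subseteq> Span K bs" using mono_Span_sublist[OF K _ bsc] ws by auto
  have fS: "fin_dim (Span K bs)" using K Span_finite_dimension bsc by blast
  have sS: "subspace (Span K bs)" using fS fin_dim_subspace by blast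
  have SB: "Span K bs \<subseteq> B" using subalgebra_Span_incl[OF K sB bsB] .
  have "dm W + card P \<le> dm (Span K bs)"
  proof (rule dual_system_dm_le[OF fS sW WS fP])
    fix i assume i: "i \<in> P"
    show "subspace (V i)" "W \<subseteq> V i" using i VP W_def by auto
    show "f i \<in> Span K bs" using i P(1) sbs Span_base_incl[OF K bsc] by auto
    show "f i \<notin> V i" using i P(2) f_def by auto
    show "f i \<in> V j" if "j \<in> P - {i}" for j using that i P(1) fV by auto
  qed
  hence "dm B \<le> dm (Span K bs)" using P(5) W_def by simp
  hence SpB: "Span K bs = B" using dm_mono[OF B(1) sS SB] by auto
  hence ob: "ordered_basis K bs B"
    unfolding ordered_basis_def using independent_of_dm_Span[OF bsc] B bs_def by simp
  \<comment> \<open>All entries of \<open>bs\<close> other than \<open>f i\<close> lie in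
    \<open>V i\<close>. Hence a member of \<open>V i\<close> has coefficient zero at
    \<open>f i\<close>; otherwise \<open>f i\<close> itself would lie in \<open>V i\<close>.\<close>
  have match: "U i \<subseteq> Span K (take i bs @ drop (Suc i) bs)" if i: "i \<in> P" for i
  proof
    fix v assume "v \<in> U i"
    hence vV: "v \<in> V i" using VP i by blast
    let ?o = "take i bs @ drop (Suc i) bs"
    have iN: "i < n" using i P(1) by auto
    have so: "set ?o = f ` ({..<n} - {i})"
      using set_take_drop_Suc[of i bs] iN bs_def by auto
    have oc: "set ?o \<subseteq> carrier R" using so sbs bsc by auto
    have fic: "f i \<in> carrier R" using iN sbs bsc by auto
    have "Span K (f i # ?o) = B"
      using Span_same_set[OF K, of "f i # ?o" bs] so sbs iN oc fic SpB by auto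
    hence "v \<in> line_extension K (f i) (Span K ?o)" using vV VP i by auto
    then obtain k y where ky: "k \<in> K" "y \<in> Span K ?o" "v = k \<otimes> f i \<oplus> y"
      by (auto simp: line_extension_mem_iff)
    have "Span K ?o \<subseteq> V i" using so fV i VP by (intro subalgebra_Span_incl[OF K]) auto
    hence yV: "y \<in> V i" using ky by auto
    have kc: "k \<in> carrier R" "y \<in> carrier R"
      using scalar_in_carrier[OF ky(1)] subspaceD(2)[OF VP(1)[OF i] yV] by auto
    have "k = \<zero>"
    proof (rule ccontr)
      assume k0: "k \<noteq> \<zero>"
      have "v \<ominus> y \<in> V i" using vV yV subspaceD(7)[OF VP(1)[OF i]] by auto
      moreover have "v \<ominus> y = k \<otimes> f i" unfolding ky(3) using kc fic by algebra
      moreover have "inv k \<in> K" using K ky(1) k0 subfield_m_inv(1) by blast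
      ultimately have "inv k \<otimes> (k \<otimes> f i) \<in> V i" using subspaceD(6)[OF VP(1)[OF i]] by metis
      moreover have "inv k \<otimes> (k \<otimes> f i) = f i"
        using kc k0 fic field_Units by (simp flip: m_assoc)
      ultimately show False using P(2)[OF i] i f_def by auto
    qed
    thus "v \<in> Span K ?o" using ky kc fic by simp
  qed
  \<comment> \<open>The set \<open>P\<close> may be too large: a matching with defect
    \<open>l\<close> asks for exactly \<open>n - l\<close> indices, so \<open>P\<close> is cut down
    to \<open>Q\<close>.\<close>
  have "n - l \<le> card P" using P(4,5) Vn B by simp
  then obtain Q where "Q \<subseteq> P" "card Q = n - l" using obtain_subset_with_card_n by metis
  thus ?thesis using ob match P(1) by (intro exI[of _ bs] exI[of _ Q]) auto
qed

section \<open>Matchings and obstructions\<close>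

lemma zero_notin_independent: "independent K Us \<Longrightarrow> \<zero> \<notin> set Us"
proof (induction Us)
  case (Cons v Us)
  have "set Us \<subseteq> carrier R"
    using independent_in_carrier[OF Cons.prems] by simp
  hence "v \<noteq> \<zero>"
    using independent_backwards(1)[OF Cons.prems] Span_subgroup_props(2)[OF K] by metis
  then show ?case using Cons.IH[OF independent_backwards(2)[OF Cons.prems]] by simp
qed simp

lemma ordered_basis_length:
  "ordered_basis K as A \<Longrightarrow> length as = dm A"
  unfolding ordered_basis_def using dimensionI[OF K, of as A] dimension_iff[of "length as" A] by simp

lemma ordered_basis_nth:
  assumes "ordered_basis K as A" "i < length as"
  shows "as ! i \<in> A" "as ! i \<in> carrier R" "as ! i \<noteq> \<zero>"
proof -
  have c: "set as \<subseteq> carrier R" using assms independent_in_carrier unfolding ordered_basis_def by blast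
  have "as ! i \<in> set as" "set as \<subseteq> A" "\<zero> \<notin> set as"
    using assms Span_base_incl[OF K c] zero_notin_independent unfolding ordered_basis_def by auto
  with c show "as ! i \<in> A" "as ! i \<in> carrier R" "as ! i \<noteq> \<zero>" by auto
qed

text \<open>With \<open>U i\<close> the intersection of \<open>inv (as ! i) <# A\<close> and
  \<open>B\<close>, the common intersection over \<open>J\<close> is the set displayed in the
  conclusion. Without an obstruction, Rado's condition would hold for every \<open>J\<close> and
  provide a matched basis.\<close>

lemma obstruction_if_not_matched:
  assumes A: "fin_dim A" "dm A = n" and B: "fin_dim B" "dm B = n"
    and "l \<le> n" and not_matched: "\<not> partially_matched K A B l"
  shows "\<exists>as J. ordered_basis K as A \<and> J \<subseteq> {..<n} \<and>
           n + l < dm {x \<in> B. \<forall>i\<in>J. as ! i \<otimes> x \<in> A} + card J"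
proof -
  obtain as where as: "ordered_basis K as A"
    and no: "\<And>bs. ordered_basis K bs B \<Longrightarrow> \<not> partially_matched_bases K A B as bs l"
    using not_matched unfolding partially_matched_def by blast
  have len: "length as = n" using ordered_basis_length as A by simp
  note sA = fin_dim_subspace[OF A(1)] and sB = fin_dim_subspace[OF B(1)]
  define U where "U i = (inv (as ! i) <# A) \<inter> B" for i
  have mem: "x \<in> U i \<longleftrightarrow> x \<in> B \<and> as ! i \<otimes> x \<in> A" if "i < n" for i x
    unfolding U_def
    using scale_mem_iff[OF subspaceD(1)[OF sA] ordered_basis_nth(2,3)[OF as, of i]] that len
      subspaceD(2)[OF sB] by auto
  have U: "subspace (U i) \<and> U i \<subseteq> B" if "i < n" for i
  proof
    have "as ! i \<in> carrier R - {\<zero>}" using ordered_basis_nth[OF as] that len by simp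
    hence "inv (as ! i) \<in> carrier R - {\<zero>}"
      using field_Units Units_inv_Units by metis
    hence "fin_dim (inv (as ! i) <# A)" using scale_props(1)[OF A(1)] by auto
    thus "subspace (U i)" unfolding U_def using fin_dim_subspace sB subspace_Int by blast
  qed (auto simp: U_def)
  show ?thesis
  proof (rule ccontr)
    assume n: "\<not> ?thesis"
    have "dm (B \<inter> (\<Inter>i\<in>J. U i)) + card J \<le> n + l" if "J \<subseteq> {..<n}" for J
    proof -
      have "B \<inter> (\<Inter>i\<in>J. U i) = {x \<in> B. \<forall>i\<in>J. as ! i \<otimes> x \<in> A}" using that mem by auto
      thus ?thesis using n as that by (auto simp: not_less)
    qed
    from exists_matched_basis[OF B U this] obtain bs P where
      "ordered_basis K bs B" "P \<subseteq> {..<n}" "card P = n - l"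
      "\<forall>i\<in>P. U i \<subseteq> Span K (take i bs @ drop (Suc i) bs)" by blast
    thus False using no len \<open>l \<le> n\<close> unfolding partially_matched_bases_def U_def by blast
  qed
qed

text \<open>For \<open>i\<close> in \<open>J \<inter> P\<close> the space \<open>T\<close> lies in
  the span of the basis vectors other than \<open>bs ! i\<close>. These hyperplanes have the basis
  vectors as dual system, so \<open>dm T + card (J \<inter> P)\<close> is at most
  \<open>dm B\<close>; the rest is counting \<open>J \<union> P\<close>.\<close>

lemma matched_imp_bound:
  assumes A: "subspace A" and B: "fin_dim B"
    and as: "ordered_basis K as A" and bs: "ordered_basis K bs B" and len: "length as = length bs"
    and T: "subspace T" "T \<subseteq> B" and J: "J \<subseteq> {..<length as}"
    and prod: "\<And>i t. i \<in> J \<Longrightarrow> t \<in> T \<Longrightarrow> as ! i \<otimes> t \<in> A"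
    and matched: "partially_matched_bases K A B as bs d"
  shows "dm T + card J \<le> length as + d"
proof -
  obtain P where P: "P \<subseteq> {..<length as}" "card P = length as - d" "d \<le> length as"
    "\<And>i. i \<in> P \<Longrightarrow> (inv (as ! i) <# A) \<inter> B \<subseteq> Span K (take i bs @ drop (Suc i) bs)"
    using matched unfolding partially_matched_bases_def by blast
  have bi: "independent K bs" and bS: "Span K bs = B" using bs ordered_basis_def by auto
  have bc: "set bs \<subseteq> carrier R" using bi independent_in_carrier by blast
  define H where "H i = Span K (take i bs @ drop (Suc i) bs)" for i
  have so: "set (take i bs @ drop (Suc i) bs) = (!) bs ` ({..<length bs} - {i})"
    if "i < length bs" for i by (rule set_take_drop_Suc[OF that])
  have oc: "set (take i bs @ drop (Suc i) bs) \<subseteq> carrier R" for i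
    using bc set_take_subset[of i bs] set_drop_subset[of "Suc i" bs] by auto
  have fP: "finite P" "finite J" using finite_subset[OF P(1)] finite_subset[OF J] by auto
  have "dm T + card (J \<inter> P) \<le> dm B"
  proof (rule dual_system_dm_le[OF B T, of _ H "(!) bs"])
    fix i assume i: "i \<in> J \<inter> P"
    hence il: "i < length bs" "i < length as" using P len by auto
    show "subspace (H i)"
      unfolding H_def using oc Span_is_subalgebra[OF K] by blast
    show "bs ! i \<in> B" using ordered_basis_nth[OF bs il(1)] by simp
    show "T \<subseteq> H i"
    proof
      fix t assume t: "t \<in> T"
      have "t \<in> inv (as ! i) <# A"
        using scale_mem_iff[OF subspaceD(1)[OF A] ordered_basis_nth(2,3)[OF as il(2)]]
          prod i t subspaceD(2)[OF T(1)] by blast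
      thus "t \<in> H i" using P(4)[of i] i t T unfolding H_def by blast
    qed
    have "set bs = set (bs ! i # (take i bs @ drop (Suc i) bs))"
      unfolding list.set(2) so[OF il(1)] using il(1) by (auto simp: set_conv_nth)
    hence "independent K (bs ! i # (take i bs @ drop (Suc i) bs))"
      using independent_same_set[OF K _ _ bi] il by auto
    thus "bs ! i \<notin> H i" unfolding H_def using independent_backwards(1) by blast
    fix j assume "j \<in> J \<inter> P - {i}"
    hence j: "j < length bs" "j \<noteq> i" using P len by auto
    hence "bs ! i \<in> set (take j bs @ drop (Suc j) bs)" using so[OF j(1)] il by auto
    thus "bs ! i \<in> H j" unfolding H_def using Span_base_incl[OF K oc] by blast
  qed (use fP in auto)
  moreover have "dm B = length as" using ordered_basis_length[OF bs] len by simp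
  moreover have "card (J \<union> P) \<le> length as" using P J by (metis Un_least card_lessThan card_mono finite_lessThan)
  moreover have "card (J \<union> P) + card (J \<inter> P) = card J + card P" using card_Un_Int fP by metis
  ultimately show ?thesis using P by linarith
qed

text \<open>The empty index set imposes no condition. This is the witness that makes the
  \<open>LEAST\<close> in \<open>deficiency\<close> attained.\<close>

lemma partially_matched_trivial:
  assumes "fin_dim A" "fin_dim B" "dm A = dm B"
  shows "partially_matched K A B (dm A)"
proof -
  obtain bs where "ordered_basis K bs B" using ex_basis[OF assms(2)] ordered_basis_def by metis
  thus ?thesis unfolding partially_matched_def partially_matched_bases_def
    using ordered_basis_length by (metis card.empty diff_self_eq_0 empty_iff empty_subsetI order_refl)
qed

section \<open>Stabilizers and Dyson transforms\<close>

text \<open>A \<open>K\<close>-basis of \<open>E\<close> also spans \<open>E\<close> over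
  \<open>H\<close>, because its \<open>H\<close>-span is a \<open>K\<close>-subspace contained in
  \<open>E\<close>.\<close>

lemma fin_dim_over_larger:
  assumes H: "subfield H R" "K \<subseteq> H" and E: "fin_dim E" and sE: "subalgebra H E R"
  shows "finite_dimension H E"
proof -
  obtain Us where Us: "Span K Us = E" "set Us \<subseteq> E" using ex_basis[OF E] by metis
  have c: "set Us \<subseteq> carrier R" using Us subalgebra_in_carrier[OF sE] by blast
  interpret H: extension R H using H(1) extension.intro[OF field_axioms] extension_axioms.intro by blast
  have "subspace (Span H Us)"
    by (rule subspaceI) (use H.subspaceD[OF Span_is_subalgebra[OF H(1) c]] H(2) in auto)
  moreover have "set Us \<subseteq> Span H Us" using Span_base_incl[OF H(1) c] .
  ultimately have "E \<subseteq> Span H Us" using subalgebra_Span_incl[OF K] Us(1) by metis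
  moreover have "Span H Us \<subseteq> E" using subalgebra_Span_incl[OF H(1) sE Us(2)] .
  ultimately show ?thesis using Span_finite_dimension[OF H(1) c] by simp
qed

lemma nonzero_inv:
  assumes "z \<in> carrier R" "z \<noteq> \<zero>"
  shows "inv z \<in> carrier R" "inv z \<noteq> \<zero>" "z \<otimes> inv z = \<one>" "inv z \<otimes> z = \<one>"
proof -
  have "z \<in> Units R" using assms field_Units by auto
  thus "inv z \<in> carrier R" "z \<otimes> inv z = \<one>" "inv z \<otimes> z = \<one>" by auto
  thus "inv z \<noteq> \<zero>" using assms by force
qed

text \<open>Multiplication by a nonzero \<open>z\<close> in \<open>H\<close> maps \<open>X\<close>
  injectively into itself, hence onto by dimension, which gives inverses. Finiteness follows since
  \<open>x0\<close> multiplies \<open>H\<close> into \<open>X\<close>, and divisibility is the tower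
  law for \<open>X\<close> as an \<open>H\<close>-space.\<close>

lemma stabilizer_subfield:
  assumes X: "fin_dim X" "x0 \<in> X" "x0 \<noteq> \<zero>"
  defines "H \<equiv> {z \<in> carrier R. \<forall>x\<in>X. z \<otimes> x \<in> X}"
  shows "subfield H R" "K \<subseteq> H" "fin_dim H" "dm H dvd dm X"
proof -
  note sX = fin_dim_subspace[OF X(1)]
  have Xc: "x \<in> carrier R" if "x \<in> X" for x using that subspaceD(2)[OF sX] by blast
  show KH: "K \<subseteq> H" unfolding H_def using subspaceD(6)[OF sX] scalar_in_carrier by blast
  have H: "z \<in> H \<longleftrightarrow> z \<in> carrier R \<and> (\<forall>x\<in>X. z \<otimes> x \<in> X)" for z by (simp add: H_def)
  have sr: "subring H R"
  proof (rule subringI)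
    fix a b assume "a \<in> H" "b \<in> H"
    thus "a \<otimes> b \<in> H" "a \<oplus> b \<in> H"
      using Xc subspaceD(4)[OF sX] by (auto simp: H m_assoc l_distr)
  next
    fix a assume "a \<in> H"
    thus "\<ominus> a \<in> H" using Xc subspaceD(5)[OF sX] by (auto simp: H l_minus)
  qed (use Xc in \<open>auto simp: H\<close>)
  show sf: "subfield H R"
  proof (rule subfieldI'[OF sr])
    fix z assume "z \<in> H - {\<zero>}"
    hence z: "z \<in> carrier R" "z \<noteq> \<zero>" "\<And>x. x \<in> X \<Longrightarrow> z \<otimes> x \<in> X" by (auto simp: H)
    note iz = nonzero_inv[OF z(1,2)]
    have "z <# X \<subseteq> X" using z by (auto simp: l_coset_def)
    hence zX: "z <# X = X"
      using dm_mono(2)[OF X(1)] scale_props[OF X(1) z(1,2)] fin_dim_subspace by blast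
    have "inv z \<otimes> x \<in> X" if "x \<in> X" for x
    proof -
      have "x \<in> z <# X" using that zX by simp
      then obtain x' where "x' \<in> X" "x = z \<otimes> x'" by (auto simp: l_coset_def)
      moreover have "inv z \<otimes> (z \<otimes> x') = x'"
        using z iz Xc \<open>x' \<in> X\<close> by (simp flip: m_assoc)
      ultimately show ?thesis by simp
    qed
    thus "inv z \<in> H" using iz by (simp add: H)
  qed
  have sH: "subspace H"
    by (rule subspaceI) (use subringE[OF sr] KH in auto)
  note ix = nonzero_inv[OF Xc[OF X(2)] X(3)]
  have "H \<subseteq> inv x0 <# X"
    unfolding subset_iff scale_mem_iff[OF subspaceD(1)[OF sX] Xc[OF X(2)] X(3)]
    using X(2) Xc by (auto simp: H m_comm)
  thus fH: "fin_dim H"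
    using fin_dim_subset[OF scale_props(1)[OF X(1) ix(1,2)] sH] by blast
  have "subalgebra H X R"
    using sX unfolding subalgebra_def subalgebra_axioms_def by (auto simp: H)
  hence "finite_dimension H X" using fin_dim_over_larger[OF sf KH X(1)] by blast
  thus "dm H dvd dm X" using telescopic_base_dim(2)[OF K sf fH] by simp
qed

text \<open>
  For \<open>y\<^sub>0 \<in> Y\<close>, \<open>x \<in> X\<close> and \<open>z = x y\<^sub>0\<^sup>-\<^sup>1\<close>, the Dyson transform \<open>(X + z Y, Y \<inter> z\<^sup>-\<^sup>1 X)\<close> keeps the
  dimension sum, and \<open>y\<^sub>0\<close> survives in its second component. If it never shrinks \<open>Y\<close>, then
  \<open>y\<^sub>0\<^sup>-\<^sup>1 Y\<close> lies in the stabilizer field \<open>H\<close> of \<open>X\<close>, and \<open>m = dim X\<close> works.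
\<close>

lemma weak_kneser:
  assumes A: "fin_dim A" and X: "fin_dim X" "X \<noteq> {\<zero>}" and Y: "fin_dim Y" "Y \<noteq> {\<zero>}"
    and prod: "\<And>x y. x \<in> X \<Longrightarrow> y \<in> Y \<Longrightarrow> x \<otimes> y \<in> A"
  shows "\<exists>H m. subfield H R \<and> K \<subseteq> H \<and> fin_dim H \<and> dm H dvd m \<and> 0 < m \<and> m \<le> dm A \<and>
           dm X + dm Y \<le> m + dm H"
  using X Y prod
proof (induction "dm Y" arbitrary: X Y rule: less_induct)
  case less
  note X = less.prems(1,2) and Y = less.prems(3,4) and prod = less.prems(5)
  note sA = fin_dim_subspace[OF A] and sX = fin_dim_subspace[OF X(1)]
    and sY = fin_dim_subspace[OF Y(1)]
  have Xc: "x \<in> carrier R" if "x \<in> X" for x using that subspaceD(2)[OF sX] by blast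
  have Yc: "y \<in> carrier R" if "y \<in> Y" for y using that subspaceD(2)[OF sY] by blast
  obtain x0 where x0: "x0 \<in> X" "x0 \<noteq> \<zero>" using X subspaceD(3)[OF sX] by blast
  obtain y0 where y0: "y0 \<in> Y" "y0 \<noteq> \<zero>" using Y subspaceD(3)[OF sY] by blast
  note iy = nonzero_inv[OF Yc[OF y0(1)] y0(2)]
  show ?case
  proof (cases "\<forall>x\<in>X. \<forall>y\<in>Y. (x \<otimes> inv y0) \<otimes> y \<in> X")
    case True
    define H where "H = {z \<in> carrier R. \<forall>x\<in>X. z \<otimes> x \<in> X}"
    note H = stabilizer_subfield[OF X(1) x0, folded H_def]
    have "inv y0 <# Y \<subseteq> H"
    proof
      fix h assume "h \<in> inv y0 <# Y"
      then obtain y where y: "y \<in> Y" "h = inv y0 \<otimes> y" by (auto simp: l_coset_def)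
      have "h \<otimes> x = (x \<otimes> inv y0) \<otimes> y" if "x \<in> X" for x
        using y Yc[OF y(1)] Xc[OF that] iy by algebra
      thus "h \<in> H" using True y Yc[OF y(1)] iy unfolding H_def by auto
    qed
    moreover have "subspace (inv y0 <# Y)" "dm (inv y0 <# Y) = dm Y"
      using scale_props[OF Y(1) iy(1,2)] fin_dim_subspace by auto
    ultimately have "dm Y \<le> dm H" using dm_mono(1)[OF H(3)] by metis
    moreover have "dm X \<le> dm A"
    proof -
      have "y0 <# X \<subseteq> A" using prod y0 Yc Xc by (auto simp: l_coset_def m_comm)
      thus ?thesis
        using scale_props[OF X(1) Yc[OF y0(1)] y0(2)] dm_mono(1)[OF A] fin_dim_subspace by metis
    qed
    ultimately show ?thesis using H dm_gt_0[OF X(1) x0] by (intro exI[of _ H] exI[of _ "dm X"]) auto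
  next
    case False
    then obtain x y1 where xy: "x \<in> X" "y1 \<in> Y" "(x \<otimes> inv y0) \<otimes> y1 \<notin> X" by blast
    define z where "z = x \<otimes> inv y0"
    have z: "z \<in> carrier R" using xy Xc iy z_def by auto
    have z0: "z \<noteq> \<zero>" using xy z_def Yc subspaceD(3)[OF sX] by auto
    have zy0: "z \<otimes> y0 = x" using xy(1) Xc Yc[OF y0(1)] iy z_def by (simp add: m_assoc)
    define X' where "X' = X <+>\<^bsub>R\<^esub> (z <# Y)"
    define Y' where "Y' = {y \<in> Y. z \<otimes> y \<in> X}"
    have sY': "subspace Y'"
      by (rule subspaceI)
        (use z Yc subspaceD[OF sX] subspaceD[OF sY] scalar_in_carrier in
          \<open>auto simp: Y'_def r_distr m_lcomm\<close>)
    have fY': "fin_dim Y'" using fin_dim_subset[OF Y(1) sY'] Y'_def by auto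
    note zY = scale_props[OF Y(1) z z0] and zY' = scale_props[OF fY' z z0]
    have fX': "fin_dim X'" unfolding X'_def using dm_sum(1)[OF X(1) zY(1)] .
    \<comment> \<open>What the sum \<open>X'\<close> loses to overlap is a scaled copy of
      \<open>Y'\<close>, so the dimension sum is preserved.\<close>
    have "X \<inter> (z <# Y) = z <# Y'" by (auto simp: l_coset_def Y'_def)
    hence sum: "dm X' + dm Y' = dm X + dm Y"
      unfolding X'_def using dm_sum(2)[OF X(1) zY(1)] zY zY' by simp
    have "Y' \<noteq> Y" using xy z_def Y'_def by auto
    hence "dm Y' \<noteq> dm Y" using dm_mono(2)[OF Y(1) sY'] Y'_def by blast
    moreover have "dm Y' \<le> dm Y" using dm_mono(1)[OF Y(1) sY'] Y'_def by blast
    ultimately have less': "dm Y' < dm Y" by simp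
    have "X \<subseteq> X'" unfolding X'_def using sum_incl(1)[OF sX fin_dim_subspace[OF zY(1)]] .
    hence X'0: "X' \<noteq> {\<zero>}" using x0 by auto
    have "y0 \<in> Y'" using y0 zy0 xy Y'_def by auto
    hence Y'0: "Y' \<noteq> {\<zero>}" using y0 by auto
    \<comment> \<open>The transformed pair still multiplies into \<open>A\<close>: in
      \<open>(x1 + z y2) v = x1 v + (z v) y2\<close> the factor \<open>z v\<close> belongs to
      \<open>X\<close> by the choice of \<open>Y'\<close>.\<close>
    have prod': "u \<otimes> v \<in> A" if uv: "u \<in> X'" "v \<in> Y'" for u v
    proof -
      obtain x1 y2 where x1: "x1 \<in> X" "y2 \<in> Y" "u = x1 \<oplus> z \<otimes> y2"
        using uv(1) unfolding X'_def sum_mem_iff l_coset_def by blast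
      have v: "v \<in> Y" "z \<otimes> v \<in> X" using uv(2) Y'_def by auto
      have "u \<otimes> v = x1 \<otimes> v \<oplus> (z \<otimes> v) \<otimes> y2"
        unfolding x1(3) using Xc[OF x1(1)] Yc[OF x1(2)] Yc[OF v(1)] z by algebra
      thus ?thesis using prod[OF x1(1) v(1)] prod[OF v(2) x1(2)] subspaceD(4)[OF sA] by simp
    qed
    show ?thesis
      using less.hyps[OF less' fX' X'0 fY' Y'0 prod'] sum by simp
  qed
qed

text \<open>As long as the list is shorter than the dimension of the big field, its span is proper
  and a vector outside it can be put in front. In infinite dimension the bound on \<open>m\<close>
  is vacuous.\<close>

lemma extend_independent:
  assumes "independent K Us" "length Us \<le> m" "fin_dim (carrier R) \<Longrightarrow> m \<le> dm (carrier R)"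
  shows "\<exists>Vs. independent K (Vs @ Us) \<and> length (Vs @ Us) = m"
  using assms(2,3)
proof (induction m rule: dec_induct)
  case base
  show ?case using assms(1) by (intro exI[of _ "[]"]) simp
next
  case (step m)
  have "m \<le> dm (carrier R)" if "fin_dim (carrier R)" using step.prems[OF that] by simp
  then obtain Vs where Vs: "independent K (Vs @ Us)" "length (Vs @ Us) = m"
    using step.IH by blast
  have d: "dimension m K (Span K (Vs @ Us))" using dimensionI[OF K Vs(1)] Vs(2) by simp
  have "Span K (Vs @ Us) \<noteq> carrier R"
    using d step.prems by (auto simp: dimension_iff simp del: Span.simps)
  moreover have "Span K (Vs @ Us) \<subseteq> carrier R"
    using subspaceD(1) fin_dim_subspace d dimension_iff by blast
  ultimately obtain u where "u \<in> carrier R" "u \<notin> Span K (Vs @ Us)" by blast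
  then have "independent K ((u # Vs) @ Us)" using li_Cons Vs(1) by (metis append_Cons)
  then show ?case using Vs(2) by (intro exI[of _ "u # Vs"]) simp
qed

text \<open>The selected entries are moved to the front; this keeps both the set and the length of
  the list, hence independence, which passes to the front part.\<close>

lemma independent_nths:
  assumes "independent K as"
  shows "independent K (nths as J)"
proof -
  have "set as = set (nths as J @ nths as (- J))"
    by (simp add: set_nths) (auto simp: set_conv_nth)
  moreover have "length as = length (nths as J @ nths as (- J))"
  proof -
    have "{..<length as} = {i. i < length as \<and> i \<in> J} \<union> {i. i < length as \<and> i \<in> - J}" by auto
    hence "card {..<length as} = card {i. i < length as \<and> i \<in> J} + card {i. i < length as \<and> i \<in> - J}"
      by (simp add: card_Un_disjnt disjnt_iff)
    thus ?thesis by (simp add: length_nths)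
  qed
  ultimately have "independent K (nths as J @ nths as (- J))"
    using independent_same_set[OF K _ _ assms] by blast
  thus ?thesis using independent_split(2)[OF K] by blast
qed

section \<open>Deficiency and intermediate fields\<close>

lemma intermediate_field_if_deficiency_gt:
  assumes n: "fin_dim (carrier R) \<longrightarrow> n < dm (carrier R)"
    and A: "fin_dim A" "dm A = n" and B: "fin_dim B" "dm B = n" "\<one> \<notin> B"
    and def: "deficiency K A B > l"
  shows "\<exists>F. intermediate_field K F \<and> F \<noteq> K \<and> F \<noteq> carrier R \<and> fin_dim F \<and> dm F \<le> n \<and>
           (\<forall>j\<in>{1..l + 1}. \<not> dm F dvd (n + j))"
proof -
  note sA = fin_dim_subspace[OF A(1)] and sB = fin_dim_subspace[OF B(1)]
  have pm: "partially_matched K A B n" using partially_matched_trivial A B by metis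
  hence "deficiency K A B \<le> n" unfolding deficiency_def by (rule Least_le)
  hence "l \<le> n" using def by simp
  moreover have "\<not> partially_matched K A B l"
    using def not_less_Least unfolding deficiency_def by blast
  ultimately obtain as J where as: "ordered_basis K as A" and J: "J \<subseteq> {..<n}"
    and big: "n + l < dm {x \<in> B. \<forall>i\<in>J. as ! i \<otimes> x \<in> A} + card J"
    using obstruction_if_not_matched[OF A B(1,2)] by blast
  have len: "length as = n" using ordered_basis_length[OF as] A by simp
  have asn: "as ! i \<in> A" "as ! i \<in> carrier R" if "i \<in> J" for i
    using ordered_basis_nth[OF as, of i] len J that by auto
  define T where "T = {x \<in> B. \<forall>i\<in>J. as ! i \<otimes> x \<in> A}"
  have sT: "subspace T"
    by (rule subspaceI)
      (use subspaceD[OF sA] subspaceD[OF sB] asn scalar_in_carrier in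
        \<open>auto simp: T_def r_distr m_lcomm\<close>)
  have TB: "T \<subseteq> B" unfolding T_def by auto
  have fT: "fin_dim T" using fin_dim_subset[OF B(1) sT TB] .
  have dT: "dm T \<le> n" using dm_mono(1)[OF B(1) sT TB] B by simp
  define X where "X = Span K (nths as J)"
  have ind: "independent K (nths as J)"
    using as independent_nths unfolding ordered_basis_def by blast
  have "{i. i < length as \<and> i \<in> J} = J" using J len by auto
  hence "dimension (card J) K X"
    using dimensionI[OF K ind] unfolding X_def length_nths by simp
  hence X: "fin_dim X" "dm X = card J" by (simp_all add: dimension_iff)
  \<comment> \<open>As \<open>dm T\<close> is at most \<open>n\<close>, the obstruction inequality
    forces \<open>J\<close> to be nonempty.\<close>
  have X0: "X \<noteq> {\<zero>}"
  proof
    assume "X = {\<zero>}"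
    hence "dm X = 0" using dimI[OF K zero_dim] by simp
    thus False using X(2) big dT unfolding T_def by simp
  qed
  \<comment> \<open>Adjoining \<open>\<one>\<close> gains one dimension because
    \<open>\<one> \<notin> B\<close>, and products with it stay in \<open>A\<close> because
    \<open>X\<close> lies in \<open>A\<close>.\<close>
  define Y where "Y = line_extension K \<one> T"
  have oneT: "\<one> \<notin> T" using B TB by auto
  have Y: "fin_dim Y" "dm Y = Suc (dm T)" using dm_line_extension[OF fT _ oneT] Y_def by auto
  have "\<one> \<in> Y" using line_extension_incl(2)[OF sT] Y_def by auto
  hence Y0: "Y \<noteq> {\<zero>}" by auto
  \<comment> \<open>The condition on products is known only for the basis vectors
    \<open>as ! i\<close>; the subspace \<open>Z\<close> carries it over to their span
    \<open>X\<close>.\<close>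
  define Z where "Z = {x \<in> A. \<forall>t\<in>T. x \<otimes> t \<in> A}"
  have "subspace Z"
    by (rule subspaceI)
      (use subspaceD[OF sA] subspaceD[OF sT] scalar_in_carrier in
        \<open>auto simp: Z_def l_distr m_assoc\<close>)
  moreover have "set (nths as J) \<subseteq> Z" using asn by (auto simp: set_nths Z_def T_def)
  ultimately have XZ: "X \<subseteq> Z" unfolding X_def by (rule subalgebra_Span_incl[OF K])
  have prod: "x \<otimes> y \<in> A" if "x \<in> X" "y \<in> Y" for x y
  proof -
    obtain k t where kt: "k \<in> K" "t \<in> T" "y = k \<otimes> \<one> \<oplus> t"
      using \<open>y \<in> Y\<close> unfolding Y_def line_extension_mem_iff by blast
    have x: "x \<in> A" "x \<otimes> t \<in> A" using XZ that(1) kt Z_def by auto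
    have "x \<otimes> y = k \<otimes> x \<oplus> x \<otimes> t"
      unfolding kt(3) using subspaceD(2)[OF sA x(1)] subspaceD(2)[OF sT kt(2)]
        scalar_in_carrier[OF kt(1)] by algebra
    thus ?thesis using x kt subspaceD(4,6)[OF sA] by simp
  qed
  obtain H m where H: "subfield H R" "K \<subseteq> H" "fin_dim H" and m: "dm H dvd m" "0 < m" "m \<le> n"
    and le: "dm X + dm Y \<le> m + dm H"
    using weak_kneser[OF A(1) X(1) X0 Y(1) Y0 prod] A(2) by auto
  \<comment> \<open>One unit comes from the strict obstruction inequality, the other from adjoining
    \<open>\<one>\<close> to \<open>T\<close>. With \<open>m \<le> n\<close> this also gives
    \<open>dm H \<ge> 2\<close>, so \<open>H\<close> is not \<open>K\<close>.\<close>
  have h: "n + l + 2 \<le> m + dm H" using le X(2) Y(2) big T_def by simp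
  have "dm H \<le> n" using m dvd_imp_le[OF m(1,2)] by simp
  moreover have "H \<noteq> K"
    using h m dimI[OF K dimension_one[OF K]] by auto
  moreover have "H \<noteq> carrier R" using \<open>dm H \<le> n\<close> n H(3) by auto
  moreover have "\<not> dm H dvd (n + j)" if j: "j \<in> {1..l + 1}" for j
  proof
    assume "dm H dvd n + j"
    hence "dm H dvd (n + j - m)" using m by simp
    thus False using dvd_imp_le[of "dm H" "n + j - m"] j h m by auto
  qed
  ultimately show ?thesis using H unfolding intermediate_field_def by blast
qed

lemma deficiency_gt_if_intermediate_field:
  assumes n: "fin_dim (carrier R) \<longrightarrow> n < dm (carrier R)"
    and F: "subfield F R" "K \<subseteq> F" "fin_dim F" "dm F \<le> n"
    and ndvd: "\<forall>j\<in>{1..l + 1}. \<not> dm F dvd (n + j)"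
  shows "\<exists>A B. dimension n K A \<and> dimension n K B \<and> \<one> \<notin> B \<and> deficiency K A B > l"
proof -
  define h where "h = dm F"
  have dF: "dimension h K F" using F by (simp add: dimension_iff h_def)
  have oneF: "\<one> \<in> F" using F(1) by (simp add: subfieldE(1) subringE(3))
  have h0: "h > 0" using dm_gt_0[OF F(3) oneF] h_def by simp
  define q r where "q = n div h" and "r = n mod h"
  have n_eq: "n = h * q + r" unfolding q_def r_def by simp
  have "r < h" using h0 r_def by simp
  have rl: "r + l + 1 < h"
  proof (rule ccontr)
    assume "\<not> ?thesis"
    hence "h - r \<in> {1..l + 1}" using \<open>r < h\<close> by auto
    moreover have "n + (h - r) = h * (q + 1)" using n_eq \<open>r < h\<close> by simp
    ultimately show False using ndvd h_def by (metis dvd_triv_left)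
  qed
  interpret F: extension R F
    using F(1) extension.intro[OF field_axioms] extension_axioms.intro by blast
  \<comment> \<open>There is room for \<open>q\<close> vectors independent over \<open>F\<close>,
    since \<open>h * q \<le> n\<close> is below the degree, which the tower law factors as
    \<open>h\<close> times the degree over \<open>F\<close>.\<close>
  have "q \<le> (dim over F) (carrier R)" if "finite_dimension F (carrier R)"
  proof -
    have "h * q \<le> n" using n_eq by simp
    also have "n < h * (dim over F) (carrier R)"
      using telescopic_base_dim[OF K F(1,3) that] n h_def by simp
    finally show ?thesis by simp
  qed
  then obtain Ms where Ms: "independent F Ms" "length Ms = q"
    using F.extend_independent[of "[]" q] by auto
  define M where "M = Span F Ms"
  have FM: "dimension q F M" unfolding M_def using dimensionI[OF F(1) Ms(1)] Ms(2) by simp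
  have sFM: "subalgebra F M R" using FM F.fin_dim_subspace F.dimension_iff by blast
  have M: "fin_dim M" "dm M = h * q"
    using telescopic_base[OF K F(1) dF FM] dimension_iff by auto
  obtain ms where ms: "independent K ms" "length ms = h * q" "Span K ms = M" "set ms \<subseteq> M"
    using ex_basis[OF M(1)] M(2) by metis
  obtain Vs where Vs: "independent K (Vs @ ms)" "length (Vs @ ms) = n"
    using extend_independent[OF ms(1), of n] ms(2) n n_eq by auto
  \<comment> \<open>The basis of \<open>M\<close> is placed first, so that the obstructing index set
    is simply \<open>{..<h * q}\<close>.\<close>
  define as where "as = ms @ Vs"
  have as: "independent K as" "length as = n"
    using independent_same_set[OF K _ _ Vs(1), of as] Vs(2) as_def by auto
  define A where "A = Span K as"
  have dA: "dimension n K A" unfolding A_def using dimensionI[OF K as(1)] as(2) by simp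
  have asc: "set as \<subseteq> carrier R" using as independent_in_carrier by blast
  have MA: "M \<subseteq> A" unfolding A_def ms(3)[symmetric]
    by (rule mono_Span_sublist[OF K _ asc]) (simp add: as_def)
  have one: "independent K [\<one>]" by (auto intro: li_Cons)
  obtain Ts where Ts: "length (Ts @ [\<one>]) = h" "independent K (Ts @ [\<one>])" "Span K (Ts @ [\<one>]) = F"
    using complete_base[OF K dF one] oneF by auto
  have Tc: "set (Ts @ [\<one>]) \<subseteq> carrier R" using Ts(2) independent_in_carrier by blast
  define T where "T = Span K Ts"
  have TF: "T \<subseteq> F" unfolding T_def Ts(3)[symmetric]
    using mono_Span_append(1)[OF K, of Ts "[\<one>]"] Tc by simp
  \<comment> \<open>Since \<open>n\<close> is strictly below the degree, \<open>n + 1\<close>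
    independent vectors ending in \<open>\<one>\<close> exist. Dropping the final
    \<open>\<one>\<close> leaves a basis of \<open>B\<close>, whose span therefore avoids
    \<open>\<one>\<close>.\<close>
  obtain Ws where Ws: "independent K (Ws @ Ts @ [\<one>])" "length (Ws @ Ts @ [\<one>]) = n + 1"
    using extend_independent[OF Ts(2), of "n + 1"] Ts(1) F(4) n h_def by auto
  have Wi: "independent K ((Ws @ Ts) @ [\<one>])" using Ws(1) by simp
  define B where "B = Span K (Ws @ Ts)"
  have dB: "dimension n K B"
    unfolding B_def using dimensionI[OF K independent_split(2)[OF K Wi]] Ws(2) by simp
  have "\<one> \<in> Span K [\<one>]" using Span_base_incl[OF K, of "[\<one>]"] by simp
  hence oneB: "\<one> \<notin> B"
    using independent_split(3)[OF K Wi] B_def zero_not_one by (metis IntI singletonD)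
  have Wc: "set (Ws @ Ts) \<subseteq> carrier R" using Ws(1) independent_in_carrier by fastforce
  have TB: "T \<subseteq> B" unfolding B_def T_def using mono_Span_append(2)[OF K] Wc by simp
  have "length Ts = h - 1" using Ts(1) by simp
  hence dT: "dimension (h - 1) K T"
    unfolding T_def using dimensionI[OF K independent_split(2)[OF K Ts(2)]] by simp
  have A: "fin_dim A" "dm A = n" and B: "fin_dim B" "dm B = n" and T: "fin_dim T" "dm T = h - 1"
    using dA dB dT by (simp_all add: dimension_iff)
  have "deficiency K A B > l"
  proof (rule ccontr)
    define d where "d = deficiency K A B"
    assume "\<not> deficiency K A B > l"
    hence "d \<le> l" by (simp add: d_def)
    have "partially_matched K A B n" using partially_matched_trivial A B by metis
    hence "partially_matched K A B d" unfolding d_def deficiency_def by (rule LeastI)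
    moreover have oA: "ordered_basis K as A" using as A_def ordered_basis_def by blast
    ultimately obtain bs where bs: "ordered_basis K bs B" "partially_matched_bases K A B as bs d"
      unfolding partially_matched_def by blast
    \<comment> \<open>This would read \<open>h - 1 + h * q \<le> h * q + r + d\<close> with
      \<open>d \<le> l\<close>, contrary to \<open>rl\<close>.\<close>
    have "dm T + card {..<h * q} \<le> length as + d"
    proof (rule matched_imp_bound[OF _ B(1) oA bs(1) _ _ TB _ _ bs(2)])
      show "length as = length bs" using ordered_basis_length[OF bs(1)] as B by simp
      show "{..<h * q} \<subseteq> {..<length as}" using as n_eq by auto
      fix i t assume i: "i \<in> {..<h * q}" and t: "t \<in> T"
      have "as ! i \<in> M" using i ms(2,4) as_def by (auto simp: nth_append)
      moreover have "t \<otimes> as ! i \<in> M" using calculation t TF F.subspaceD(6)[OF sFM] by blast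
      moreover have "t \<in> carrier R" "as ! i \<in> carrier R"
        using t TF F.scalar_in_carrier calculation(1) F.subspaceD(2)[OF sFM] by auto
      ultimately show "as ! i \<otimes> t \<in> A" using MA m_comm by auto
    qed (use A T fin_dim_subspace in auto)
    thus False using T(2) as n_eq \<open>d \<le> l\<close> rl by simp
  qed
  thus ?thesis using dA dB oneB by blast
qed

end

theorem theorem4p3:
  fixes L :: "('a, 'b) ring_scheme" and K :: "'a set" and l n :: nat
  assumes "field L" and "subfield K L" and "K \<noteq> carrier L"
    and "\<exists>F. ring.intermediate_field L K F \<and> F \<noteq> K \<and> F \<noteq> carrier L \<and>
           ring.finite_dimension L K F"
    and "ring.n0 L K \<le> n"
    and "ring.finite_dimension L K (carrier L) \<longrightarrow> n < (ring.dim L over K) (carrier L)"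
  shows "(\<exists>A B. ring.dimension L n K A \<and> ring.dimension L n K B \<and> \<one>\<^bsub>L\<^esub> \<notin> B \<and>
            ring.deficiency L K A B > l)
         \<longleftrightarrow>
         (\<exists>F. ring.intermediate_field L K F \<and> F \<noteq> K \<and> F \<noteq> carrier L \<and>
            ring.finite_dimension L K F \<and> (ring.dim L over K) F \<le> n \<and>
            (\<forall>j\<in>{1..l + 1}. \<not> (ring.dim L over K) F dvd (n + j)))"
proof -
  interpret extension L K
    by (rule extension.intro[OF assms(1) extension_axioms.intro[OF assms(2)]])
  show ?thesis
  proof
    assume "\<exists>A B. dimension n K A \<and> dimension n K B \<and> \<one>\<^bsub>L\<^esub> \<notin> B \<and> deficiency K A B > l"
    then obtain A B where "fin_dim A" "dm A = n" "fin_dim B" "dm B = n"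
      "\<one>\<^bsub>L\<^esub> \<notin> B" "deficiency K A B > l"
      unfolding dimension_iff by auto
    from intermediate_field_if_deficiency_gt[OF assms(6) this]
    show "\<exists>F. intermediate_field K F \<and> F \<noteq> K \<and> F \<noteq> carrier L \<and> fin_dim F \<and> dm F \<le> n \<and>
            (\<forall>j\<in>{1..l + 1}. \<not> dm F dvd (n + j))" .
  next
    assume "\<exists>F. intermediate_field K F \<and> F \<noteq> K \<and> F \<noteq> carrier L \<and> fin_dim F \<and> dm F \<le> n \<and>
            (\<forall>j\<in>{1..l + 1}. \<not> dm F dvd (n + j))"
    then obtain F where "subfield F L" "K \<subseteq> F" "fin_dim F" "dm F \<le> n"
      "\<forall>j\<in>{1..l + 1}. \<not> dm F dvd (n + j)"
      unfolding intermediate_field_def by auto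
    from deficiency_gt_if_intermediate_field[OF assms(6) this]
    show "\<exists>A B. dimension n K A \<and> dimension n K B \<and> \<one>\<^bsub>L\<^esub> \<notin> B \<and> deficiency K A B > l" .
  qed
qed

end
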